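(* Let $(W_1,I_1)$ and $(W_2,I_2)$ be Coxeter groups and let $c=(J_1,J_2,\delta)$, $c'=(J'_1,J'_2,\delta')$ be admissible triples for $W_1\times W_2$. For every $(J_1^{(n)}, J_2^{\prime (n)}, w_1^{(n)}, w_2^{(n)})_{n \ge 0}\in \mathcal T(c,c')$ the sequence $(w_1^{(m)},w_2^{(m)})_m$ is eventually constant, and $$(J_1^{(n)}, J_2^{\prime (n)}, w_1^{(n)}, w_2^{(n)})_{n \ge 0} \mapsto (w_1^{(m)}, w_2^{(m)}) \quad\text{for } m \gg 0$$ is a well-defined bijection $\phi: \mathcal T(c, c') \rightarrow {}^{J'_1} W_1 \times W_2^{J_2}$.
   Context: Coxeter groups $(W,I)$ have finite $I$; subsets of $I$ are identified with sets of simple reflections, $W_J$ is the standard parabolic subgroup generated by $J$, $W^J$ (resp. ${}^JW$) is the set of minimal length representatives of $W/W_J$ (resp. $W_J\backslash W$), ${}^KW^J={}^KW\cap W^J$, and $wK=wKw^{-1}$ for $w\in W$. An admissible triple for $W_1\times W_2$ is $c=(J_1,J_2,\delta)$ with $J_1\subset I_1$, $J_2\subset I_2$ and $\delta:W_{J_1}\to W_{J_2}$ a group isomorphism with $\delta(J_1)=J_2$. For admissible triples $c=(J_1,J_2,\delta)$ and $c'=(J'_1,J'_2,\delta')$, $\mathcal T(c,c')$ is the set of all sequences $(J_1^{(n)}, J_2^{\prime (n)}, w_1^{(n)}, w_2^{(n)})_{n \ge 0}$ with $J_1^{(n)}\subset J_1$, $J_2^{\prime(n)}\subset J'_2$, $w_1^{(n)}\in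 W_1$, $w_2^{(n)}\in W_2$ such that: (a) $J_1^{(0)}=J_1$ and $J_2^{\prime(0)}=\delta'(w_1^{(0)}J_1\cap J'_1)$; (b) $J_1^{(n)}=\delta^{-1}\bigl((w_2^{(n-1)})^{-1}J_2^{\prime(n-1)}\cap J_2\bigr)$ for $n\ge 1$; (c) $J_2^{\prime(n)}=\delta'(w_1^{(n)}J_1^{(n)}\cap J'_1)$ for $n\ge 1$; (d) $w_1^{(n)}\in {}^{J'_1}W_1^{J_1^{(n)}}$ and $w_2^{(n)}\in {}^{J_2^{\prime(n)}}W_2^{J_2}$ for $n\ge 0$; (e) $w_1^{(n)}\in w_1^{(n-1)}W_{J_1^{(n-1)}}$ and $w_2^{(n)}\in W_{J_2^{\prime(n-1)}}w_2^{(n-1)}$ for $n\ge 1$. *)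

theory Defs
  imports "HOL-Algebra.Algebra"
begin

definition word_prod :: "('a, 'm) monoid_scheme \<Rightarrow> 'a list \<Rightarrow> 'a" where
  "word_prod G ws = foldr (\<lambda>s w. s \<otimes>\<^bsub>G\<^esub> w) ws \<one>\<^bsub>G\<^esub>"

text \<open>
  Equality of words in the abstract group with generators \<open>S\<close> and defining relations
  \<open>(s t)\<^sup>m = 1\<close>, where \<open>m\<close> is the order of \<open>s t\<close> in \<open>G\<close>. Formal inverses of letters are not
  needed: taking \<open>s = t\<close> gives \<open>m = 1\<close>, hence the relation \<open>s s = 1\<close>. If \<open>s t\<close> has infinite order,
  then \<open>group.ord\<close> is \<open>0\<close> and rule \<open>rel\<close> only says that the empty word equals itself, so no
  relation is imposed.
\<close>

inductive coxeter_eq :: "('a, 'm) monoid_scheme \<Rightarrow> 'a set \<Rightarrow> 'a list \<Rightarrow> 'a list \<Rightarrow> bool"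
  for G S where
    rel: "\<lbrakk>s \<in> S; t \<in> S\<rbrakk>
            \<Longrightarrow> coxeter_eq G S (concat (replicate (group.ord G (s \<otimes>\<^bsub>G\<^esub> t)) [s, t])) []"
  | refl: "u \<in> lists S \<Longrightarrow> coxeter_eq G S u u"
  | sym: "coxeter_eq G S u v \<Longrightarrow> coxeter_eq G S v u"
  | trans: "\<lbrakk>coxeter_eq G S u v; coxeter_eq G S v w\<rbrakk> \<Longrightarrow> coxeter_eq G S u w"
  | ctxt: "\<lbrakk>coxeter_eq G S u v; x \<in> lists S; y \<in> lists S\<rbrakk>
            \<Longrightarrow> coxeter_eq G S (x @ u @ y) (x @ v @ y)"

text \<open>
  \<open>(G, S)\<close> is a Coxeter group of finite rank: \<open>S\<close> is a finite generating set of elements of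
  order \<open>2\<close>, and \<open>G\<close> is presented by \<open>S\<close> subject to the relations above.
\<close>

locale coxeter_group = group G for G :: "('a, 'm) monoid_scheme" (structure) +
  fixes S :: "'a set"
  assumes finite_S: "finite S"
    and S_subset: "S \<subseteq> carrier G"
    and S_ord: "\<And>s. s \<in> S \<Longrightarrow> ord s = 2"
    and S_generates: "generate G S = carrier G"
    and presentation: "\<And>u v. \<lbrakk>u \<in> lists S; v \<in> lists S\<rbrakk>
                         \<Longrightarrow> word_prod G u = word_prod G v \<longleftrightarrow> coxeter_eq G S u v"

definition coxeter_length :: "('a, 'm) monoid_scheme \<Rightarrow> 'a set \<Rightarrow> 'a \<Rightarrow> nat" where
  "coxeter_length G S w = (LEAST n. \<exists>ws \<in> lists S. length ws = n \<and> word_prod G ws = w)"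

text \<open>
  The minimal length representatives of \<open>W / W\<^sub>J\<close>, of \<open>W\<^sub>K \ W\<close>, and the intersection of the two.
\<close>

definition min_reps_right :: "('a, 'm) monoid_scheme \<Rightarrow> 'a set \<Rightarrow> 'a set \<Rightarrow> 'a set" where
  "min_reps_right G S J = {w \<in> carrier G.
     \<forall>v \<in> w <#\<^bsub>G\<^esub> generate G J. coxeter_length G S w \<le> coxeter_length G S v}"

definition min_reps_left :: "('a, 'm) monoid_scheme \<Rightarrow> 'a set \<Rightarrow> 'a set \<Rightarrow> 'a set" where
  "min_reps_left G S K = {w \<in> carrier G.
     \<forall>v \<in> generate G K #>\<^bsub>G\<^esub> w. coxeter_length G S w \<le> coxeter_length G S v}"

definition min_reps :: "('a, 'm) monoid_scheme \<Rightarrow> 'a set \<Rightarrow> 'a set \<Rightarrow> 'a set \<Rightarrow> 'a set" where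
  "min_reps G S K J = min_reps_left G S K \<inter> min_reps_right G S J"

definition conj_set :: "('a, 'm) monoid_scheme \<Rightarrow> 'a \<Rightarrow> 'a set \<Rightarrow> 'a set" where
  "conj_set G w K = (\<lambda>k. w \<otimes>\<^bsub>G\<^esub> k \<otimes>\<^bsub>G\<^esub> inv\<^bsub>G\<^esub> w) ` K"

definition admissible_triple ::
  "('a, 'm) monoid_scheme \<Rightarrow> 'a set \<Rightarrow> ('b, 'n) monoid_scheme \<Rightarrow> 'b set
    \<Rightarrow> 'a set \<Rightarrow> 'b set \<Rightarrow> ('a \<Rightarrow> 'b) \<Rightarrow> bool" where
  "admissible_triple W1 I1 W2 I2 J1 J2 \<delta> \<longleftrightarrow>
     J1 \<subseteq> I1 \<and> J2 \<subseteq> I2 \<and>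
     \<delta> \<in> iso (W1\<lparr>carrier := generate W1 J1\<rparr>) (W2\<lparr>carrier := generate W2 J2\<rparr>) \<and>
     \<delta> ` J1 = J2"

text \<open>
  \<open>\<delta>\<close> is a map on \<open>generate W1 J1\<close> only; its values elsewhere are irrelevant, so its preimages are
  cut down to that domain. The index sets \<open>J\<^sub>1\<^sup>(\<^sup>n\<^sup>)\<close> and \<open>J'\<^sub>2\<^sup>(\<^sup>n\<^sup>)\<close> are \<open>A n\<close> and \<open>B n\<close>,
  and \<open>w\<^sub>1\<^sup>(\<^sup>n\<^sup>)\<close> and \<open>w\<^sub>2\<^sup>(\<^sup>n\<^sup>)\<close> are \<open>w1 n\<close> and \<open>w2 n\<close>.
\<close>

definition T_seqs ::
  "('a, 'm) monoid_scheme \<Rightarrow> 'a set \<Rightarrow> ('b, 'n) monoid_scheme \<Rightarrow> 'b set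
    \<Rightarrow> 'a set \<Rightarrow> 'b set \<Rightarrow> ('a \<Rightarrow> 'b) \<Rightarrow> 'a set \<Rightarrow> 'b set \<Rightarrow> ('a \<Rightarrow> 'b)
    \<Rightarrow> (nat \<Rightarrow> 'a set \<times> 'b set \<times> 'a \<times> 'b) set" where
  "T_seqs W1 I1 W2 I2 J1 J2 \<delta> J1' J2' \<delta>' =
     {(\<lambda>n. (A n, B n, w1 n, w2 n)) | A B w1 w2.
        (\<forall>n. A n \<subseteq> J1 \<and> B n \<subseteq> J2' \<and> w1 n \<in> carrier W1 \<and> w2 n \<in> carrier W2) \<and>
        A 0 = J1 \<and>
        (\<forall>n. A (Suc n) = (\<delta> -` (conj_set W2 (inv\<^bsub>W2\<^esub> (w2 n)) (B n) \<inter> J2)) \<inter> generate W1 J1) \<and>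
        (\<forall>n. B n = \<delta>' ` (conj_set W1 (w1 n) (A n) \<inter> J1')) \<and>
        (\<forall>n. w1 n \<in> min_reps W1 I1 J1' (A n) \<and> w2 n \<in> min_reps W2 I2 (B n) J2) \<and>
        (\<forall>n. w1 (Suc n) \<in> w1 n <#\<^bsub>W1\<^esub> generate W1 (A n) \<and>
             w2 (Suc n) \<in> generate W2 (B n) #>\<^bsub>W2\<^esub> w2 n)}"

definition eventual_value :: "(nat \<Rightarrow> 'c) \<Rightarrow> 'c" where
  "eventual_value f = (THE p. \<forall>\<^sub>F m in sequentially. f m = p)"

end

theory Submission
  imports Defs
begin

text \<open>
  If \<open>w\<close> is minimal in \<open>w W\<^sub>J\<close>, lengths add in \<open>w u\<close> for \<open>u \<in> W\<^sub>J\<close>; comparing lengths in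
  \<open>k w = w u\<close> then shows that the sets \<open>J\<^sub>1\<^sup>(\<^sup>n\<^sup>)\<close> and \<open>J'\<^sub>2\<^sup>(\<^sup>n\<^sup>)\<close> decrease, hence
  stabilise, and by uniqueness of minimal representatives so do \<open>w\<^sub>1\<^sup>(\<^sup>n\<^sup>)\<close> and \<open>w\<^sub>2\<^sup>(\<^sup>n\<^sup>)\<close>.
  The limit \<open>(v\<^sub>1, v\<^sub>2)\<close> determines the sequence recursively, since \<open>w\<^sub>1\<^sup>(\<^sup>n\<^sup>)\<close> is the minimal
  element of \<open>v\<^sub>1 W\<^sub>J\<close> for \<open>J = J\<^sub>1\<^sup>(\<^sup>n\<^sup>)\<close>, and similarly for \<open>w\<^sub>2\<^sup>(\<^sup>n\<^sup>)\<close>. Conversely, this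
  recursion makes sense for every \<open>(v\<^sub>1, v\<^sub>2)\<close>, and a count of cardinalities shows that the
  sequence it produces converges to \<open>(v\<^sub>1, v\<^sub>2)\<close>.

  Additivity of lengths comes from the parity with which each reflection occurs in the list of
  reflections of a word: it respects the Coxeter relations, so words whose reflections are
  distinct are reduced.
\<close>

section \<open>Reflections and reduced words\<close>

context coxeter_group
begin

declare in_lists_conv_set [simp del] in_listsD [rule del] in_listsI [rule del]

abbreviation len :: "'a \<Rightarrow> nat" where "len \<equiv> coxeter_length G S"

section \<open>Words in the generators and the length function\<close>

lemma word_prod_Nil [simp]: "word_prod G [] = \<one>"
  and word_prod_Cons [simp]: "word_prod G (s # ws) = s \<otimes> word_prod G ws"
  by (simp_all add: word_prod_def)

lemma in_S_carrier [simp, intro]: "s \<in> S \<Longrightarrow> s \<in> carrier G"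
  using S_subset by blast

lemma word_prod_closed [simp]: "ws \<in> lists S \<Longrightarrow> word_prod G ws \<in> carrier G"
  by (induction ws) auto

lemma word_prod_append:
  "\<lbrakk>u \<in> lists S; v \<in> lists S\<rbrakk> \<Longrightarrow> word_prod G (u @ v) = word_prod G u \<otimes> word_prod G v"
  by (induction u) (auto simp: m_assoc)

lemma S_square: assumes "s \<in> S" shows "s \<otimes> s = \<one>"
proof -
  have "s [^] (2::nat) = \<one>"
    using pow_ord_eq_1[of s] S_ord[OF assms] assms by auto
  then show ?thesis
    using assms by (simp add: numeral_2_eq_2)
qed

lemma S_inv [simp]: "s \<in> S \<Longrightarrow> inv s = s"
  using S_square by (intro inv_equality) auto

lemma rev_in_lists_iff [simp]: "rev ws \<in> lists S \<longleftrightarrow> ws \<in> lists S"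
  by (simp add: in_lists_conv_set)

lemma lists_subset: "\<lbrakk>ws \<in> lists J; J \<subseteq> S\<rbrakk> \<Longrightarrow> ws \<in> lists S"
  using lists_mono[of J S] by blast

lemma word_prod_rev: "ws \<in> lists S \<Longrightarrow> word_prod G (rev ws) = inv (word_prod G ws)"
  by (induction ws) (auto simp: word_prod_append inv_mult_group)

lemma generate_closed: "J \<subseteq> S \<Longrightarrow> u \<in> generate G J \<Longrightarrow> u \<in> carrier G"
  using generate_in_carrier[of J] S_subset by blast

lemma subgroup_generate: "J \<subseteq> S \<Longrightarrow> subgroup (generate G J) G"
  using generate_is_subgroup S_subset by auto

text \<open>Generators are involutions, so plain words suffice. Keeping the letters in
  \<open>J\<close> later allows shortening inside a parabolic subgroup.\<close>

lemma generate_word: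
  assumes "J \<subseteq> S" "u \<in> generate G J"
  shows "\<exists>ws \<in> lists J. word_prod G ws = u"
  using assms(2)
proof induction
  case one
  then show ?case by (intro bexI[of _ "[]"]) auto
next
  case (incl h)
  then show ?case using assms(1) by (intro bexI[of _ "[h]"]) auto
next
  case (inv h)
  then show ?case using assms(1) by (intro bexI[of _ "[h]"]) auto
next
  case (eng h1 h2)
  then obtain u v where "u \<in> lists J" "v \<in> lists J" "word_prod G u = h1" "word_prod G v = h2"
    by blast
  then show ?case
    using assms(1) lists_subset
    by (intro bexI[of _ "u @ v"]) (auto simp: word_prod_append)
qed

lemma carrier_word: "w \<in> carrier G \<Longrightarrow> \<exists>ws \<in> lists S. word_prod G ws = w"
  using generate_word[of S w] S_generates by auto

lemma len_le: "ws \<in> lists S \<Longrightarrow> len (word_prod G ws) \<le> length ws"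
  unfolding coxeter_length_def by (rule Least_le) auto

lemma reduced_word:
  assumes "w \<in> carrier G"
  obtains ws where "ws \<in> lists S" "word_prod G ws = w" "length ws = len w"
proof -
  have "\<exists>n. \<exists>ws \<in> lists S. length ws = n \<and> word_prod G ws = w"
    using carrier_word[OF assms] by blast
  from LeastI_ex[OF this] show thesis
    using that unfolding coxeter_length_def by blast
qed

lemma len_mult_le:
  assumes "u \<in> carrier G" "v \<in> carrier G"
  shows "len (u \<otimes> v) \<le> len u + len v"
proof -
  obtain a b where "a \<in> lists S" "word_prod G a = u" "length a = len u"
    "b \<in> lists S" "word_prod G b = v" "length b = len v"
    using reduced_word assms by metis
  then show ?thesis
    using len_le[of "a @ b"] by (simp add: word_prod_append)
qed

lemma len_inv:
  assumes "w \<in> carrier G" shows "len (inv w) = len w"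
proof -
  have le: "len (inv v) \<le> len v" if v: "v \<in> carrier G" for v
  proof -
    obtain a where a: "a \<in> lists S" "word_prod G a = v" "length a = len v"
      using reduced_word[OF v] .
    then show ?thesis
      using len_le[of "rev a"] by (simp add: word_prod_rev)
  qed
  show ?thesis
    using le[of w] le[of "inv w"] assms by simp
qed

section \<open>The reflections of a word and their parity\<close>

text \<open>For a word \<open>s1 ... sn\<close> the i-th entry is the reflection
  \<open>s1 ... s(i-1) si s(i-1) ... s1\<close>. Multiplying the product of the word by it on the
  left deletes the i-th letter.\<close>

fun refls :: "'a list \<Rightarrow> 'a list" where
  "refls [] = []"
| "refls (s # ws) = s # map (\<lambda>t. s \<otimes> t \<otimes> inv s) (refls ws)"

lemma length_refls [simp]: "length (refls ws) = length ws"
  by (induction ws) auto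

lemma refls_in_generate:
  "\<lbrakk>ws \<in> lists J; t \<in> set (refls ws)\<rbrakk> \<Longrightarrow> t \<in> generate G J"
  by (induction ws arbitrary: t) (auto intro: generate.intros)

lemma refls_closed: "ws \<in> lists S \<Longrightarrow> t \<in> set (refls ws) \<Longrightarrow> t \<in> carrier G"
  using refls_in_generate S_generates by auto

lemma refls_append:
  assumes "u \<in> lists S" "v \<in> lists S"
  shows "refls (u @ v) = refls u @ map (\<lambda>t. word_prod G u \<otimes> t \<otimes> inv (word_prod G u)) (refls v)"
  using assms(1)
proof (induction u)
  case Nil
  have "map (\<lambda>t. \<one> \<otimes> t \<otimes> inv \<one>) (refls v) = refls v"
    using refls_closed[OF assms(2)] by (intro map_idI) auto
  then show ?case by simp
next
  case (Cons s u)
  then show ?case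
    using refls_closed[OF assms(2)] by (auto simp: inv_mult_group m_assoc)
qed

lemma count_list_conj:
  assumes "g \<in> carrier G" "t \<in> carrier G" "set ts \<subseteq> carrier G"
  shows "count_list (map (\<lambda>t. g \<otimes> t \<otimes> inv g) ts) t = count_list ts (inv g \<otimes> t \<otimes> g)"
  using assms(3)
proof (induction ts)
  case (Cons x ts)
  have "g \<otimes> x \<otimes> inv g = t \<longleftrightarrow> x = inv g \<otimes> t \<otimes> g"
  proof
    assume "g \<otimes> x \<otimes> inv g = t"
    then show "x = inv g \<otimes> t \<otimes> g"
      using Cons.prems assms(1) by (auto simp: m_assoc) (simp add: m_assoc[symmetric])
  next
    assume "x = inv g \<otimes> t \<otimes> g"
    then show "g \<otimes> x \<otimes> inv g = t"
      using assms(1,2) by (simp add: m_assoc) (simp add: m_assoc[symmetric])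
  qed
  then show ?case using Cons by auto
qed auto

text \<open>The prefix \<open>u\<close> affects the second summand only through its product, so
  exchanging it for a word of equal product leaves the contribution of the later letters
  unchanged.\<close>

lemma count_list_refls_append:
  assumes "u \<in> lists S" "v \<in> lists S" "r \<in> carrier G"
  shows "count_list (refls (u @ v)) r
    = count_list (refls u) r + count_list (refls v) (inv (word_prod G u) \<otimes> r \<otimes> word_prod G u)"
proof -
  have "set (refls v) \<subseteq> carrier G"
    using refls_closed[OF assms(2)] by blast
  then show ?thesis
    using assms by (simp add: refls_append count_list_conj)
qed

text \<open>If \<open>m\<close> is the order of \<open>s t\<close>, the list below has period \<open>m\<close>, so every
  reflection occurs in it an even number of times.\<close>

lemma refls_alternating:
  assumes "s \<in> S" "t \<in> S"
  shows "refls (concat (replicate m [s, t])) = map (\<lambda>i. (s \<otimes> t) [^] i \<otimes> s) [0..<2 * m]"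
proof (induction m)
  case (Suc m)
  have st: "s \<in> carrier G" "t \<in> carrier G"
    using assms by auto
  \<comment> \<open>Conjugation by \<open>t\<close> and then by \<open>s\<close> raises the exponent
    by two, which makes room for the exponents 0 and 1 of the two new letters.\<close>
  have step: "s \<otimes> (t \<otimes> ((s \<otimes> t) [^] i \<otimes> s) \<otimes> t) \<otimes> s
      = (s \<otimes> t) [^] (Suc (Suc i)) \<otimes> s" for i :: nat
  proof -
    have "(s \<otimes> t) [^] (Suc (Suc i)) = (s \<otimes> t) \<otimes> ((s \<otimes> t) [^] i \<otimes> (s \<otimes> t))"
      using st nat_pow_mult[of "s \<otimes> t" 1 "Suc i"] by simp
    then show ?thesis
      using st assms by (simp add: m_assoc)
  qed
  have "[0..<2 * Suc m] = 0 # 1 # map (\<lambda>i. Suc (Suc i)) [0..<2 * m]"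
    using map_add_upt[of 2 "2 * m"] by (simp add: upt_conv_Cons numeral_2_eq_2 del: upt_Suc)
  then have "map (\<lambda>i. (s \<otimes> t) [^] i \<otimes> s) [0..<2 * Suc m]
      = s # (s \<otimes> t \<otimes> s) # map (\<lambda>i. (s \<otimes> t) [^] (Suc (Suc i)) \<otimes> s) [0..<2 * m]"
    using st by (simp del: upt_Suc nat_pow_Suc)
  also have "\<dots> = refls (concat (replicate (Suc m) [s, t]))"
    using assms Suc step by (simp del: nat_pow_Suc add: comp_def)
  finally show ?case by simp
qed auto

lemma coxeter_eq_lists: "coxeter_eq G S u v \<Longrightarrow> u \<in> lists S \<and> v \<in> lists S"
proof (induction rule: coxeter_eq.induct)
  case (rel s t)
  then show ?case by (auto simp: in_lists_conv_set)
qed auto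

lemma coxeter_eq_word_prod: "coxeter_eq G S u v \<Longrightarrow> word_prod G u = word_prod G v"
  using coxeter_eq_lists presentation by blast

text \<open>A relator lists every element an even number of times. In a context, \<open>u\<close>
  and \<open>v\<close> have equal products, so the counts coming from \<open>x\<close> and
  \<open>y\<close> agree.\<close>

lemma coxeter_eq_parity:
  assumes "coxeter_eq G S u v" "r \<in> carrier G"
  shows "even (count_list (refls u) r) \<longleftrightarrow> even (count_list (refls v) r)"
  using assms
proof (induction arbitrary: r rule: coxeter_eq.induct)
  case (rel s t)
  define m where "m = ord (s \<otimes> t)"
  define f where "f = (\<lambda>i::nat. (s \<otimes> t) [^] i \<otimes> s)"
  have st: "s \<otimes> t \<in> carrier G"
    using rel by auto
  \<comment> \<open>If \<open>s t\<close> has infinite order, then \<open>m\<close> is 0 and the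
    list of reflections is empty.\<close>
  have "f (i + m) = f i" for i
    using st pow_ord_eq_1[OF st] by (simp add: f_def m_def nat_pow_mult[symmetric])
  then have "map f [0..<2 * m] = map f [0..<m] @ map f [0..<m]"
    by (intro nth_equalityI) (auto simp: nth_append, metis le_add_diff_inverse2 not_less)
  then show ?case
    unfolding m_def[symmetric] refls_alternating[OF rel(1,2)] f_def[symmetric] by simp
next
  case (ctxt u v x y)
  have uv: "u \<in> lists S" "v \<in> lists S"
    using coxeter_eq_lists[OF ctxt(1)] by auto
  have *: "count_list (refls (x @ z @ y)) r = count_list (refls x) r
      + count_list (refls z) (inv (word_prod G x) \<otimes> r \<otimes> word_prod G x)
      + count_list (refls y) (inv (word_prod G z) \<otimes> (inv (word_prod G x) \<otimes> r \<otimes> word_prod G x)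
          \<otimes> word_prod G z)" if "z \<in> lists S" for z
    using that ctxt by (simp add: count_list_refls_append)
  show ?case
    using *[OF uv(1)] *[OF uv(2)] coxeter_eq_word_prod[OF ctxt(1)] ctxt by simp
qed auto

text \<open>A reflection listed once has odd count, so by parity it also occurs for a shortest word
  of the same element. That word therefore has at least as many letters as
  \<open>ws\<close>.\<close>

lemma distinct_refls_len:
  assumes "ws \<in> lists S" "distinct (refls ws)"
  shows "len (word_prod G ws) = length ws"
proof (rule antisym)
  obtain v where v: "v \<in> lists S" "word_prod G v = word_prod G ws"
      "length v = len (word_prod G ws)"
    using reduced_word[of "word_prod G ws"] assms by auto
  then have eq: "coxeter_eq G S ws v"
    using presentation assms by metis
  have "set (refls ws) \<subseteq> set (refls v)"
  proof
    fix t assume t: "t \<in> set (refls ws)"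
    then have "count_list (refls ws) t = 1"
      using assms(2) t by (metis count_mset distinct_count_atmost_1)
    then have "odd (count_list (refls v) t)"
      using coxeter_eq_parity[OF eq refls_closed[OF assms(1) t]] by (simp del: One_nat_def)
    then show "t \<in> set (refls v)"
      by (metis count_list_0_iff even_zero)
  qed
  then have "card (set (refls ws)) \<le> length (refls v)"
    by (meson List.finite_set card_length card_mono le_trans)
  then show "length ws \<le> len (word_prod G ws)"
    using assms(2) v(3) by (simp add: distinct_card)
qed (use len_le assms in auto)

text \<open>The word \<open>v\<close> is \<open>ws\<close> with the letter belonging to
  \<open>t\<close> deleted: the head if \<open>t = s\<close>, otherwise a letter of the tail, found
  after undoing the conjugation by \<open>s\<close>.\<close>

lemma exchange:
  assumes "ws \<in> lists J" "J \<subseteq> S" "t \<in> set (refls ws)"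
  shows "\<exists>v \<in> lists J. length v < length ws \<and> word_prod G v = t \<otimes> word_prod G ws"
  using assms(1,3)
proof (induction ws arbitrary: t)
  case (Cons s ws)
  then have s: "s \<in> S" "s \<in> J" and ws: "ws \<in> lists S" "ws \<in> lists J"
    using assms(2) lists_subset by auto
  show ?case
  proof (cases "t = s")
    case True
    then have "word_prod G ws = t \<otimes> word_prod G (s # ws)"
      using s ws S_square by (simp add: m_assoc[symmetric])
    then show ?thesis using ws by auto
  next
    case False
    then obtain r where r: "r \<in> set (refls ws)" "t = s \<otimes> r \<otimes> inv s"
      using Cons.prems by auto
    then obtain v where v: "v \<in> lists J" "length v < length ws"
        "word_prod G v = r \<otimes> word_prod G ws"
      using Cons.IH ws by blast
    have "word_prod G (s # v) = t \<otimes> word_prod G (s # ws)"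
      using r v s ws refls_closed[OF ws(1) r(1)] S_square
      by (simp add: m_assoc) (simp add: m_assoc[symmetric])
    then show ?thesis
      using v s by (intro bexI[of _ "s # v"]) auto
  qed
qed auto

text \<open>The deletion property. If a repetition first arises on prepending \<open>s\<close>, then
  \<open>s\<close> is the conjugate by \<open>s\<close> of a reflection of the tail, hence is itself
  that reflection, and \<open>exchange\<close> absorbs it into a word shorter than the tail.\<close>

lemma not_distinct_refls_shorten:
  assumes "ws \<in> lists J" "J \<subseteq> S" "\<not> distinct (refls ws)"
  shows "\<exists>v \<in> lists J. length v < length ws \<and> word_prod G v = word_prod G ws"
  using assms(1,3)
proof (induction ws)
  case (Cons s ws)
  then have s: "s \<in> S" "s \<in> J" and ws: "ws \<in> lists S" "ws \<in> lists J"
    using assms(2) lists_subset by auto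
  have inj: "inj_on (\<lambda>t. s \<otimes> t \<otimes> inv s) (set (refls ws))"
    using s refls_closed[OF ws(1)] by (intro inj_onI) (auto simp del: S_inv)
  show ?case
  proof (cases "distinct (refls ws)")
    case True
    then have "s \<in> (\<lambda>t. s \<otimes> t \<otimes> inv s) ` set (refls ws)"
      using Cons.prems inj by (auto simp: distinct_map)
    then obtain r where r: "r \<in> set (refls ws)" "s = s \<otimes> r \<otimes> inv s"
      by auto
    have rc: "r \<in> carrier G"
      using refls_closed[OF ws(1) r(1)] .
    have "s \<otimes> s = s \<otimes> r \<otimes> inv s \<otimes> s"
      using r(2) by simp
    then have "s = r"
      using s rc by (simp add: m_assoc del: S_inv)
    then obtain v where v: "v \<in> lists J" "length v < length ws" "word_prod G v = s \<otimes> word_prod G ws"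
      using exchange[OF ws(2) assms(2) r(1)] by blast
    then show ?thesis using v by (intro bexI[of _ v]) auto
  next
    case False
    then obtain v where "v \<in> lists J" "length v < length ws" "word_prod G v = word_prod G ws"
      using Cons.IH ws by blast
    then show ?thesis
      using s by (intro bexI[of _ "s # v"]) auto
  qed
qed auto

section \<open>Minimal length coset representatives\<close>

text \<open>Take a reduced word \<open>a\<close> of \<open>w\<close>. The reflections of
  \<open>a @ b\<close> are those of \<open>a\<close> and the conjugates by \<open>w\<close> of those
  of \<open>b\<close>. If the two parts met, \<open>exchange\<close> would give a word shorter than
  \<open>a\<close> for some \<open>w t\<close> in the coset of \<open>w\<close>, against minimality.
  So all are distinct and \<open>a @ b\<close> is reduced.\<close>

lemma len_min_rep_mult_word:
  assumes "w \<in> min_reps_right G S J" "J \<subseteq> S" "b \<in> lists J" "distinct (refls b)"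
  shows "len (w \<otimes> word_prod G b) = len w + length b"
proof -
  have w: "w \<in> carrier G"
    using assms(1) by (simp add: min_reps_right_def)
  obtain a where a: "a \<in> lists S" "word_prod G a = w" "length a = len w"
    using reduced_word[OF w] .
  have bS: "b \<in> lists S"
    using lists_subset assms(2,3) by auto
  have "distinct (refls a)"
    using not_distinct_refls_shorten[OF a(1)] a len_le by (metis leD order_refl)
  moreover have "inj_on (\<lambda>t. w \<otimes> t \<otimes> inv w) (set (refls b))"
    using w refls_closed[OF bS] by (intro inj_onI) auto
  moreover have "w \<otimes> t \<otimes> inv w \<notin> set (refls a)" if t: "t \<in> set (refls b)" for t
  proof
    assume "w \<otimes> t \<otimes> inv w \<in> set (refls a)"
    then obtain v where v: "v \<in> lists S" "length v < length a"
        "word_prod G v = w \<otimes> t \<otimes> inv w \<otimes> word_prod G a"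
      using exchange[OF a(1)] by blast
    have "word_prod G v = w \<otimes> t"
      using v(3) a(2) w refls_closed[OF bS t] by (simp add: m_assoc)
    moreover have "w \<otimes> t \<in> w <# generate G J"
      using refls_in_generate[OF assms(3) t] by (auto simp: l_coset_def)
    ultimately have "len w \<le> len (word_prod G v)"
      using assms(1) by (simp add: min_reps_right_def)
    then show False
      using len_le[OF v(1)] v(2) a(3) by simp
  qed
  ultimately have "distinct (refls (a @ b))"
    using a bS assms(4) by (auto simp: refls_append distinct_map)
  then show ?thesis
    using distinct_refls_len[of "a @ b"] a bS by (simp add: word_prod_append)
qed

text \<open>Among the words over \<open>J\<close> for \<open>u\<close>, a shortest one has distinct
  reflections, hence is reduced with respect to all of \<open>S\<close>. Length in the parabolic
  subgroup thus agrees with length in \<open>G\<close>.\<close>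

lemma generate_reduced_word:
  assumes "J \<subseteq> S" "u \<in> generate G J"
  obtains b where "b \<in> lists J" "word_prod G b = u" "length b = len u" "distinct (refls b)"
proof -
  obtain c where c: "c \<in> lists J \<and> word_prod G c = u"
    using generate_word[OF assms] by blast
  obtain b where b: "b \<in> lists J" "word_prod G b = u"
      "\<And>v. v \<in> lists J \<Longrightarrow> word_prod G v = u \<Longrightarrow> length b \<le> length v"
    using ex_has_least_nat[of "\<lambda>b. b \<in> lists J \<and> word_prod G b = u", OF c, of length] by auto
  then have d: "distinct (refls b)"
    using not_distinct_refls_shorten[OF b(1) assms(1)] by (metis leD)
  then show thesis
    using that[of b] b distinct_refls_len[of b] lists_subset assms(1) by auto
qed

lemma len_min_rep_mult:
  assumes "w \<in> min_reps_right G S J" "J \<subseteq> S" "u \<in> generate G J"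
  shows "len (w \<otimes> u) = len w + len u"
proof -
  obtain b where b: "b \<in> lists J" "word_prod G b = u" "length b = len u" "distinct (refls b)"
    using generate_reduced_word[OF assms(2,3)] .
  then show ?thesis
    using len_min_rep_mult_word[OF assms(1,2)] by metis
qed

lemma len_eq_0: assumes "w \<in> carrier G" "len w = 0" shows "w = \<one>"
  using reduced_word[OF assms(1)] assms(2) by (metis length_0_conv word_prod_Nil)

lemma generate_len_1:
  assumes "J \<subseteq> S" "u \<in> generate G J" "len u = 1"
  shows "u \<in> J"
proof -
  obtain b where b: "b \<in> lists J" "word_prod G b = u" "length b = 1"
    using generate_reduced_word[OF assms(1,2)] assms(3) by metis
  then obtain s where "b = [s]"
    by (metis One_nat_def length_0_conv length_Suc_conv)
  then show ?thesis
    using b assms(1) by auto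
qed

lemma len_S: "s \<in> S \<Longrightarrow> len s = 1"
  using distinct_refls_len[of "[s]"] by auto

lemma min_rep_right_unique:
  assumes "w \<in> min_reps_right G S J" "v \<in> min_reps_right G S J" "J \<subseteq> S"
    "v \<in> w <# generate G J"
  shows "v = w"
proof -
  have w: "w \<in> carrier G"
    using assms(1) by (simp add: min_reps_right_def)
  obtain u where u: "u \<in> generate G J" "v = w \<otimes> u"
    using assms(4) by (auto simp: l_coset_def)
  have uc: "u \<in> carrier G"
    using generate_closed[OF assms(3) u(1)] .
  have "inv u \<in> generate G J"
    using subgroup_generate[OF assms(3)] u(1) by (simp add: subgroup.m_inv_closed)
  then have "v \<otimes> inv u \<in> v <# generate G J"
    by (auto simp: l_coset_def)
  then have "len v \<le> len w"
    using assms(2) u(2) w uc by (simp add: min_reps_right_def m_assoc)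
  then have "len u = 0"
    using len_min_rep_mult[OF assms(1,3) u(1)] u(2) by simp
  then show ?thesis
    using len_eq_0 uc u(2) w by simp
qed

lemma min_rep_right_exists:
  assumes "x \<in> carrier G" "J \<subseteq> S"
  obtains w where "w \<in> min_reps_right G S J" "w \<in> x <# generate G J"
proof -
  have "x \<otimes> \<one> \<in> x <# generate G J"
    unfolding l_coset_def using generate.one by blast
  then obtain w where w: "w \<in> x <# generate G J"
      "\<And>v. v \<in> x <# generate G J \<Longrightarrow> len w \<le> len v"
    using ex_has_least_nat[of "\<lambda>v. v \<in> x <# generate G J" _ len] by blast
  moreover have "w <# generate G J = x <# generate G J"
    using l_repr_independence[OF w(1) assms(1) subgroup_generate[OF assms(2)]] by simp
  moreover have "w \<in> carrier G"
    using w(1) assms generate_closed[OF assms(2)] by (auto simp: l_coset_def)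
  ultimately show thesis
    using that[of w] by (simp add: min_reps_right_def)
qed

section \<open>From right to left minimality by inversion\<close>

lemma inv_mem_l_coset_iff:
  assumes "v \<in> carrier G" "w \<in> carrier G" "J \<subseteq> S"
  shows "inv v \<in> inv w <# generate G J \<longleftrightarrow> v \<in> generate G J #> w"
proof -
  have sg: "subgroup (generate G J) G"
    using subgroup_generate[OF assms(3)] .
  have "v = h \<otimes> w \<longleftrightarrow> inv v = inv w \<otimes> inv h" if "h \<in> generate G J" for h
    using that assms generate_closed[OF assms(3)] 
    by (metis inv_mult_group inv_inv m_closed)
  then show ?thesis
    using subgroup.m_inv_closed[OF sg] generate_closed[OF assms(3)]
    unfolding l_coset_def r_coset_def by auto (metis inv_inv)
qed

text \<open>Inversion preserves length and exchanges the two kinds of cosets. The mirrored results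
  that follow are deduced through this equivalence.\<close>

lemma min_reps_right_inv_iff:
  assumes "w \<in> carrier G" "J \<subseteq> S"
  shows "inv w \<in> min_reps_right G S J \<longleftrightarrow> w \<in> min_reps_left G S J"
proof -
  have "(\<forall>v \<in> inv w <# generate G J. len (inv w) \<le> len v)
      \<longleftrightarrow> (\<forall>v \<in> generate G J #> w. len w \<le> len v)"
    (is "?L \<longleftrightarrow> ?R")
  proof
    assume L: ?L
    show ?R
    proof
      fix v assume v: "v \<in> generate G J #> w"
      then have vc: "v \<in> carrier G"
        using assms generate_closed[OF assms(2)] by (auto simp: r_coset_def)
      then show "len w \<le> len v"
        using L v inv_mem_l_coset_iff[OF vc assms] len_inv assms(1) by metis
    qed
  next
    assume R: ?R
    show ?L
    proof
      fix v assume v: "v \<in> inv w <# generate G J"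
      then have vc: "v \<in> carrier G"
        using assms generate_closed[OF assms(2)] by (auto simp: l_coset_def)
      then show "len (inv w) \<le> len v"
        using R v inv_mem_l_coset_iff[of "inv v" w J] len_inv assms by (metis inv_closed inv_inv)
    qed
  qed
  then show ?thesis
    using assms by (simp add: min_reps_right_def min_reps_left_def)
qed

lemma min_reps_left_inv_iff:
  assumes "w \<in> carrier G" "J \<subseteq> S"
  shows "inv w \<in> min_reps_left G S J \<longleftrightarrow> w \<in> min_reps_right G S J"
  using min_reps_right_inv_iff[of "inv w" J] assms by simp

lemma min_reps_right_carrier: "w \<in> min_reps_right G S J \<Longrightarrow> w \<in> carrier G"
  and min_reps_left_carrier: "w \<in> min_reps_left G S J \<Longrightarrow> w \<in> carrier G"
  by (simp_all add: min_reps_right_def min_reps_left_def)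

lemma len_mult_min_rep:
  assumes "w \<in> min_reps_left G S J" "J \<subseteq> S" "u \<in> generate G J"
  shows "len (u \<otimes> w) = len u + len w"
proof -
  have w: "w \<in> carrier G" and u: "u \<in> carrier G"
    using assms min_reps_left_carrier generate_closed by auto
  have "inv u \<in> generate G J"
    using subgroup_generate[OF assms(2)] assms(3) by (simp add: subgroup.m_inv_closed)
  then have "len (inv w \<otimes> inv u) = len (inv w) + len (inv u)"
    using len_min_rep_mult[of "inv w" J "inv u"] min_reps_right_inv_iff[OF w assms(2)] assms by simp
  then show ?thesis
    using w u len_inv[of "u \<otimes> w"] len_inv by (simp add: inv_mult_group)
qed

lemma min_rep_left_unique:
  assumes "w \<in> min_reps_left G S J" "v \<in> min_reps_left G S J" "J \<subseteq> S"
    "v \<in> generate G J #> w"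
  shows "v = w"
proof -
  have w: "w \<in> carrier G" and v: "v \<in> carrier G"
    using assms min_reps_left_carrier by auto
  have "inv v = inv w"
    using min_rep_right_unique[of "inv w" J "inv v"] min_reps_right_inv_iff inv_mem_l_coset_iff
      assms w v by auto
  then show ?thesis
    using w v by (metis inv_inv)
qed

lemma min_rep_left_exists:
  assumes "x \<in> carrier G" "J \<subseteq> S"
  obtains w where "w \<in> min_reps_left G S J" "w \<in> generate G J #> x"
proof -
  obtain w where w: "w \<in> min_reps_right G S J" "w \<in> inv x <# generate G J"
    using min_rep_right_exists[of "inv x" J] assms by auto
  then have "inv w \<in> min_reps_left G S J" "inv w \<in> generate G J #> x"
    using min_reps_left_inv_iff inv_mem_l_coset_iff[of "inv w" x J] assms min_reps_right_carrier
    by auto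
  then show thesis using that by blast
qed

text \<open>With \<open>v = w u\<close> and lengths adding, \<open>len w + len u = len v \<le> len
  (k v) \<le> len (k w) + len u\<close> for \<open>k\<close> in the subgroup generated by
  \<open>K\<close>; now cancel \<open>len u\<close>.\<close>

lemma min_rep_right_of_left_min:
  assumes "v \<in> min_reps_left G S K" "w \<in> min_reps_right G S J" "v \<in> w <# generate G J"
    "J \<subseteq> S" "K \<subseteq> S"
  shows "w \<in> min_reps_left G S K"
proof -
  have w: "w \<in> carrier G"
    using assms min_reps_right_carrier by auto
  obtain u where u: "u \<in> generate G J" "v = w \<otimes> u"
    using assms(3) by (auto simp: l_coset_def)
  have uc: "u \<in> carrier G"
    using generate_closed[OF assms(4) u(1)] .
  have "len w \<le> len (k \<otimes> w)" if k: "k \<in> generate G K" for k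
  proof -
    have kc: "k \<in> carrier G"
      using generate_closed[OF assms(5) k] .
    have "len w + len u = len v"
      using len_min_rep_mult[OF assms(2,4) u(1)] u(2) by simp
    also have "\<dots> \<le> len (k \<otimes> v)"
      using assms(1) k by (auto simp: min_reps_left_def r_coset_def)
    also have "\<dots> = len ((k \<otimes> w) \<otimes> u)"
      using u(2) w uc kc by (simp add: m_assoc)
    also have "\<dots> \<le> len (k \<otimes> w) + len u"
      using len_mult_le w uc kc by simp
    finally show ?thesis by simp
  qed
  then show ?thesis
    using w by (auto simp: min_reps_left_def r_coset_def)
qed

lemma min_rep_left_of_right_min:
  assumes "v \<in> min_reps_right G S K" "w \<in> min_reps_left G S J" "v \<in> generate G J #> w"
    "J \<subseteq> S" "K \<subseteq> S"
  shows "w \<in> min_reps_right G S K"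
  using min_rep_right_of_left_min[of "inv v" K "inv w" J] assms
    min_reps_right_carrier[OF assms(1)] min_reps_left_carrier[OF assms(2)]
  by (simp add: min_reps_right_inv_iff min_reps_left_inv_iff inv_mem_l_coset_iff)

section \<open>Conjugates of sets of simple reflections\<close>

text \<open>An element \<open>k\<close> of the left side is \<open>w u (inv w)\<close> with
  \<open>u\<close> in the subgroup generated by \<open>J\<close>. Lengths add on both sides of
  \<open>k w = w u\<close>, so \<open>u\<close> has length 1 and belongs to \<open>J\<close>.
  Allowing another coset element \<open>w'\<close> covers the passage from one term of a sequence to
  the next.\<close>

lemma conj_set_Int_subset:
  assumes "w \<in> min_reps G S K J" "J \<subseteq> S" "K \<subseteq> S" "w' \<in> w <# generate G J" "A \<subseteq> J"
  shows "conj_set G w' A \<inter> K \<subseteq> conj_set G w J"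
proof
  fix k assume k: "k \<in> conj_set G w' A \<inter> K"
  have w: "w \<in> carrier G" "w \<in> min_reps_left G S K" "w \<in> min_reps_right G S J"
    using assms(1) min_reps_left_carrier by (auto simp: min_reps_def)
  obtain x a where x: "x \<in> generate G J" "w' = w \<otimes> x" and a: "a \<in> A"
      "k = w' \<otimes> a \<otimes> inv w'"
    using assms(4) k by (auto simp: l_coset_def conj_set_def)
  have c: "x \<in> carrier G" "a \<in> carrier G" "k \<in> carrier G"
    using generate_closed[OF assms(2) x(1)] a assms k by auto
  define u where "u = x \<otimes> a \<otimes> inv x"
  have uJ: "u \<in> generate G J"
    using x a assms(2,5) subgroup_generate[OF assms(2)] generate.incl[of a J]
    by (auto simp: u_def intro!: subgroup.m_closed subgroup.m_inv_closed)
  have uc: "u \<in> carrier G"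
    using c by (simp add: u_def)
  have kw: "k = w \<otimes> u \<otimes> inv w"
    using a x c w by (simp add: u_def m_assoc inv_mult_group)
  then have "k \<otimes> w = w \<otimes> u"
    using w uc by (simp add: m_assoc)
  moreover have "len (k \<otimes> w) = len k + len w"
    using len_mult_min_rep[OF w(2) assms(3)] k by (auto intro: generate.incl)
  moreover have "len k = 1"
    using k assms(3) len_S by auto
  ultimately have "len u = 1"
    using len_min_rep_mult[OF w(3) assms(2) uJ] by simp
  then have "u \<in> J"
    using generate_len_1[OF assms(2) uJ] by simp
  then show "k \<in> conj_set G w J"
    using kw by (auto simp: conj_set_def)
qed

lemma conj_set_inv_Int_subset:
  assumes "w \<in> min_reps G S J K" "J \<subseteq> S" "K \<subseteq> S" "w' \<in> generate G J #> w" "A \<subseteq> J"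
  shows "conj_set G (inv w') A \<inter> K \<subseteq> conj_set G (inv w) J"
proof (rule conj_set_Int_subset[OF _ assms(2,3) _ assms(5)])
  have w: "w \<in> carrier G"
    using assms(1) min_reps_left_carrier by (auto simp: min_reps_def)
  then show "inv w \<in> min_reps G S K J"
    using assms by (simp add: min_reps_def min_reps_left_inv_iff min_reps_right_inv_iff)
  have "w' \<in> carrier G"
    using assms(2,4) w generate_closed by (auto simp: r_coset_def)
  then show "inv w' \<in> inv w <# generate G J"
    using inv_mem_l_coset_iff assms w by simp
qed

lemma conj_generate:
  assumes "w \<in> carrier G" "J \<subseteq> S" "K \<subseteq> S" "conj_set G w J \<subseteq> K" "x \<in> generate G J"
  shows "w \<otimes> x \<otimes> inv w \<in> generate G K"
  using assms(5)
proof induction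
  case one
  then show ?case using assms(1) by (simp add: generate.one)
next
  case (incl h)
  then show ?case using assms(4) by (auto simp: conj_set_def intro: generate.incl)
next
  case (inv h)
  moreover have "h \<in> S" using inv assms(2) by auto
  ultimately show ?case using assms(4) by (auto simp: conj_set_def intro: generate.incl)
next
  case (eng h1 h2)
  have "h1 \<in> carrier G" "h2 \<in> carrier G"
    using eng generate_closed[OF assms(2)] by auto
  then have "w \<otimes> (h1 \<otimes> h2) \<otimes> inv w = (w \<otimes> h1 \<otimes> inv w) \<otimes> (w \<otimes> h2 \<otimes> inv w)"
    using assms(1) by (simp add: m_assoc) (simp add: m_assoc[symmetric])
  then show ?case
    using eng by (auto intro: generate.eng)
qed

text \<open>Since \<open>w x = (w x (inv w)) w\<close>, the element \<open>v\<close> also lies in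
  the coset of \<open>w\<close> under left multiplication by the subgroup generated by
  \<open>K\<close>, where left minimal elements are unique.\<close>

lemma l_coset_min_rep_left_eq:
  assumes "w \<in> min_reps_left G S K" "v \<in> min_reps_left G S K" "J \<subseteq> S" "K \<subseteq> S"
    "conj_set G w J \<subseteq> K" "v \<in> w <# generate G J"
  shows "v = w"
proof -
  have w: "w \<in> carrier G"
    using assms(1) min_reps_left_carrier by auto
  obtain x where x: "x \<in> generate G J" "v = w \<otimes> x"
    using assms(6) by (auto simp: l_coset_def)
  have "v = (w \<otimes> x \<otimes> inv w) \<otimes> w"
    using x w generate_closed[OF assms(3) x(1)] by (simp add: m_assoc)
  then have "v \<in> generate G K #> w"
    using conj_generate[OF w assms(3-5) x(1)] by (auto simp: r_coset_def)
  then show ?thesis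
    using min_rep_left_unique[OF assms(1,2,4)] by simp
qed

lemma r_coset_min_rep_right_eq:
  assumes "w \<in> min_reps_right G S K" "v \<in> min_reps_right G S K" "J \<subseteq> S" "K \<subseteq> S"
    "conj_set G (inv w) J \<subseteq> K" "v \<in> generate G J #> w"
  shows "v = w"
proof -
  have c: "w \<in> carrier G" "v \<in> carrier G"
    using assms min_reps_right_carrier by auto
  have "inv v = inv w"
    using l_coset_min_rep_left_eq[of "inv w" K "inv v" J] assms c
    by (simp add: min_reps_left_inv_iff inv_mem_l_coset_iff)
  then show ?thesis
    using c by (metis inv_inv)
qed

section \<open>Coset calculus, and minimal representatives as functions\<close>

lemma l_coset_generate_sym:
  "\<lbrakk>w \<in> x <# generate G J; x \<in> carrier G; J \<subseteq> S\<rbrakk> \<Longrightarrow> x \<in> w <# generate G J"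
  using l_coset_swap[OF _ _ subgroup_generate] by blast

lemma l_coset_generate_trans:
  assumes "y \<in> x <# generate G J" "z \<in> y <# generate G K" "x \<in> carrier G" "K \<subseteq> J" "J \<subseteq> S"
  shows "z \<in> x <# generate G J"
proof -
  obtain h k where hk: "h \<in> generate G J" "y = x \<otimes> h" "k \<in> generate G K" "z = y \<otimes> k"
    using assms(1,2) by (auto simp: l_coset_def)
  then have k: "k \<in> generate G J"
    using mono_generate[OF assms(4)] by blast
  have "z = x \<otimes> (h \<otimes> k)"
    using hk k assms(3) generate_closed[OF assms(5)] by (simp add: m_assoc)
  then show ?thesis
    using generate.eng[OF hk(1) k] by (auto simp: l_coset_def)
qed

lemma mem_own_l_coset: "x \<in> carrier G \<Longrightarrow> x \<in> x <# generate G J"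
  unfolding l_coset_def using generate.one[of G J] by force

lemma r_coset_carrier:
  "\<lbrakk>w \<in> generate G J #> x; x \<in> carrier G; J \<subseteq> S\<rbrakk> \<Longrightarrow> w \<in> carrier G"
  using generate_closed by (auto simp: r_coset_def)

lemma r_coset_generate_sym:
  assumes "w \<in> generate G J #> x" "x \<in> carrier G" "J \<subseteq> S"
  shows "x \<in> generate G J #> w"
  using l_coset_generate_sym[of "inv w" "inv x" J] r_coset_carrier[OF assms] assms
  by (simp add: inv_mem_l_coset_iff)

lemma r_coset_generate_trans:
  assumes "y \<in> generate G J #> x" "z \<in> generate G K #> y" "x \<in> carrier G" "K \<subseteq> J" "J \<subseteq> S"
  shows "z \<in> generate G J #> x"
proof -
  have y: "y \<in> carrier G"
    using r_coset_carrier assms by blast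
  then have z: "z \<in> carrier G"
    using r_coset_carrier[OF assms(2)] assms by blast
  show ?thesis
    using l_coset_generate_trans[of "inv y" "inv x" J "inv z" K] assms y z
    by (simp add: inv_mem_l_coset_iff)
qed

lemma mem_own_r_coset: "x \<in> carrier G \<Longrightarrow> x \<in> generate G J #> x"
  unfolding r_coset_def using generate.one[of G J] by force

text \<open>Minimal elements of cosets exist and are unique for \<open>x\<close> in the group and
  \<open>J\<close> inside \<open>S\<close>. Having them as a function lets sequences be defined by
  recursion.\<close>

definition right_rep :: "'a \<Rightarrow> 'a set \<Rightarrow> 'a" where
  "right_rep x J = (THE w. w \<in> min_reps_right G S J \<and> x \<in> w <# generate G J)"

definition left_rep :: "'a set \<Rightarrow> 'a \<Rightarrow> 'a" where
  "left_rep J x = (THE w. w \<in> min_reps_left G S J \<and> x \<in> generate G J #> w)"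

lemma right_rep_eq:
  assumes "w \<in> min_reps_right G S J" "x \<in> w <# generate G J" "J \<subseteq> S"
  shows "right_rep x J = w"
  unfolding right_rep_def
proof (rule the_equality)
  fix v assume v: "v \<in> min_reps_right G S J \<and> x \<in> v <# generate G J"
  have w: "w \<in> carrier G" and vc: "v \<in> carrier G"
    using assms(1) v min_reps_right_carrier by auto
  have "v \<in> x <# generate G J"
    using l_coset_generate_sym vc v assms(3) by blast
  then have "v \<in> w <# generate G J"
    using l_coset_generate_trans[OF assms(2) _ w order_refl assms(3)] by blast
  then show "v = w"
    using min_rep_right_unique assms v by blast
qed (use assms in auto)

lemma left_rep_eq:
  assumes "w \<in> min_reps_left G S J" "x \<in> generate G J #> w" "J \<subseteq> S"
  shows "left_rep J x = w"
  unfolding left_rep_def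
proof (rule the_equality)
  fix v assume v: "v \<in> min_reps_left G S J \<and> x \<in> generate G J #> v"
  have w: "w \<in> carrier G" and vc: "v \<in> carrier G"
    using assms(1) v min_reps_left_carrier by auto
  have "v \<in> generate G J #> x"
    using r_coset_generate_sym vc v assms(3) by blast
  then have "v \<in> generate G J #> w"
    using r_coset_generate_trans[OF assms(2) _ w order_refl assms(3)] by blast
  then show "v = w"
    using min_rep_left_unique assms v by blast
qed (use assms in auto)

lemma right_rep:
  assumes "x \<in> carrier G" "J \<subseteq> S"
  shows "right_rep x J \<in> min_reps_right G S J" "x \<in> right_rep x J <# generate G J"
proof -
  obtain w where w: "w \<in> min_reps_right G S J" "w \<in> x <# generate G J"
    using min_rep_right_exists[OF assms] .
  then have "x \<in> w <# generate G J"
    using l_coset_generate_sym assms by blast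
  then show "right_rep x J \<in> min_reps_right G S J" "x \<in> right_rep x J <# generate G J"
    using right_rep_eq w assms by auto
qed

lemma left_rep:
  assumes "x \<in> carrier G" "J \<subseteq> S"
  shows "left_rep J x \<in> min_reps_left G S J" "x \<in> generate G J #> left_rep J x"
proof -
  obtain w where w: "w \<in> min_reps_left G S J" "w \<in> generate G J #> x"
    using min_rep_left_exists[OF assms] .
  then have "x \<in> generate G J #> w"
    using r_coset_generate_sym assms by blast
  then show "left_rep J x \<in> min_reps_left G S J" "x \<in> generate G J #> left_rep J x"
    using left_rep_eq w assms by auto
qed

text \<open>Both representatives lie in the coset of \<open>x\<close> modulo \<open>J\<close>. This
  supplies condition (e) for the recursive sequences.\<close>

lemma right_rep_mono:
  assumes "x \<in> carrier G" "K \<subseteq> J" "J \<subseteq> S"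
  shows "right_rep x K \<in> right_rep x J <# generate G J"
proof -
  have K: "K \<subseteq> S" using assms by blast
  note c = min_reps_right_carrier[OF right_rep(1)]
  have "right_rep x K \<in> x <# generate G K"
    using l_coset_generate_sym right_rep(2) c assms(1) K by blast
  then show ?thesis
    using l_coset_generate_trans right_rep(2) c assms by blast
qed

lemma left_rep_mono:
  assumes "x \<in> carrier G" "K \<subseteq> J" "J \<subseteq> S"
  shows "left_rep K x \<in> generate G J #> left_rep J x"
proof -
  have K: "K \<subseteq> S" using assms by blast
  note c = min_reps_left_carrier[OF left_rep(1)]
  have "left_rep K x \<in> generate G K #> x"
    using r_coset_generate_sym left_rep(2) c assms(1) K by blast
  then show ?thesis
    using r_coset_generate_trans left_rep(2) c assms by blast
qed

text \<open>Supplies condition (d): right minimality holds by construction, left minimality is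
  inherited from \<open>x\<close>.\<close>

lemma right_rep_left_min:
  assumes "x \<in> min_reps_left G S K" "J \<subseteq> S" "K \<subseteq> S"
  shows "right_rep x J \<in> min_reps G S K J"
  using min_rep_right_of_left_min[OF assms(1) right_rep assms(2,3)] right_rep(1)
    min_reps_left_carrier[OF assms(1)] assms by (simp add: min_reps_def)

lemma left_rep_right_min:
  assumes "x \<in> min_reps_right G S K" "J \<subseteq> S" "K \<subseteq> S"
  shows "left_rep J x \<in> min_reps G S J K"
  using min_rep_left_of_right_min[OF assms(1) left_rep assms(2,3)] left_rep(1)
    min_reps_right_carrier[OF assms(1)] assms by (simp add: min_reps_def)

lemma inj_on_conj: "\<lbrakk>w \<in> carrier G; J \<subseteq> S\<rbrakk> \<Longrightarrow> inj_on (\<lambda>k. w \<otimes> k \<otimes> inv w) J"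
  by (intro inj_onI) (auto simp: subset_iff)

lemma card_conj_set: "\<lbrakk>w \<in> carrier G; J \<subseteq> S\<rbrakk> \<Longrightarrow> card (conj_set G w J) = card J"
  unfolding conj_set_def by (intro card_image inj_on_conj)

end

section \<open>Stabilisation of decreasing finite sets\<close>

lemma decseq_finite_stable:
  fixes A :: "nat \<Rightarrow> 'c set"
  assumes "\<And>n. A (Suc n) \<subseteq> A n" "finite (A 0)"
  shows "\<exists>N. \<forall>n\<ge>N. A n = A N"
proof -
  have dec: "A n \<subseteq> A m" if "m \<le> n" for m n
    using that assms(1) lift_Suc_antimono_le[of A] by blast
  have fin: "finite (A n)" for n
    using dec[of 0 n] assms(2) finite_subset by blast
  obtain N where N: "\<And>n. card (A N) \<le> card (A n)"
    using ex_has_least_nat[of "\<lambda>_. True" 0 "\<lambda>n. card (A n)"] by auto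
  have "\<forall>n\<ge>N. A n = A N"
    using dec fin N by (simp add: card_seteq)
  then show ?thesis ..
qed

section \<open>The sequences attached to a pair of admissible triples\<close>

locale admissible_pair = C1: coxeter_group W1 I1 + C2: coxeter_group W2 I2
  for W1 :: "('a, 'm) monoid_scheme" and I1 and W2 :: "('b, 'n) monoid_scheme" and I2 +
  fixes J1 J1' :: "'a set" and J2 J2' :: "'b set" and \<delta> \<delta>' :: "'a \<Rightarrow> 'b"
  assumes adm: "admissible_triple W1 I1 W2 I2 J1 J2 \<delta>"
    and adm': "admissible_triple W1 I1 W2 I2 J1' J2' \<delta>'"
begin

lemma subsets: "J1 \<subseteq> I1" "J1' \<subseteq> I1" "J2 \<subseteq> I2" "J2' \<subseteq> I2"
  and images: "\<delta> ` J1 = J2" "\<delta>' ` J1' = J2'"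
  and inj_delta: "inj_on \<delta> (generate W1 J1)"
  using adm adm' by (auto simp: admissible_triple_def iso_def bij_betw_def)

text \<open>The maps \<open>next_B\<close> and \<open>next_A\<close> are the assignments in
  conditions (c) and (b), isolated so that they serve both for given sequences and for the
  recursion.\<close>

definition next_B :: "'a \<Rightarrow> 'a set \<Rightarrow> 'b set" where
  "next_B w K = \<delta>' ` (conj_set W1 w K \<inter> J1')"

definition next_A :: "'b \<Rightarrow> 'b set \<Rightarrow> 'a set" where
  "next_A w L = \<delta> -` (conj_set W2 (inv\<^bsub>W2\<^esub> w) L \<inter> J2) \<inter> generate W1 J1"

definition T_data where
  "T_data A B w1 w2 \<longleftrightarrow>
     (\<forall>n. A n \<subseteq> J1 \<and> B n \<subseteq> J2' \<and> w1 n \<in> carrier W1 \<and> w2 n \<in> carrier W2) \<and>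
     A 0 = J1 \<and> (\<forall>n. A (Suc n) = next_A (w2 n) (B n)) \<and>
     (\<forall>n. B n = next_B (w1 n) (A n)) \<and>
     (\<forall>n. w1 n \<in> min_reps W1 I1 J1' (A n) \<and> w2 n \<in> min_reps W2 I2 (B n) J2) \<and>
     (\<forall>n. w1 (Suc n) \<in> w1 n <#\<^bsub>W1\<^esub> generate W1 (A n) \<and>
          w2 (Suc n) \<in> generate W2 (B n) #>\<^bsub>W2\<^esub> w2 n)"

abbreviation T where "T \<equiv> T_seqs W1 I1 W2 I2 J1 J2 \<delta> J1' J2' \<delta>'"

lemma next_B_subset: "next_B w K \<subseteq> J2'"
  using images by (auto simp: next_B_def)

text \<open>Elements of \<open>J2\<close> are images of \<open>J1\<close>, and injectivity of
  \<delta> on the subgroup generated by \<open>J1\<close> leaves them no other preimage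
  there.\<close>

lemma next_A_subset: "next_A w L \<subseteq> J1"
proof
  fix x assume x: "x \<in> next_A w L"
  then have "\<delta> x \<in> \<delta> ` J1"
    using images by (simp add: next_A_def)
  then obtain y where y: "y \<in> J1" "\<delta> x = \<delta> y"
    by blast
  have "x = y"
    using inj_onD[OF inj_delta y(2)] x y(1) by (simp add: next_A_def generate.incl)
  then show "x \<in> J1"
    using y by simp
qed

lemma T_iff: "\<sigma> \<in> T \<longleftrightarrow>
  (\<exists>A B w1 w2. \<sigma> = (\<lambda>n. (A n, B n, w1 n, w2 n)) \<and> T_data A B w1 w2)"
  unfolding T_seqs_def T_data_def next_A_def next_B_def by simp

lemma next_B_mono:
  assumes "w \<in> min_reps W1 I1 J1' K" "K \<subseteq> I1" "w' \<in> w <#\<^bsub>W1\<^esub> generate W1 K" "K' \<subseteq> K"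
  shows "next_B w' K' \<subseteq> next_B w K"
  using C1.conj_set_Int_subset[OF assms(1,2) subsets(2) assms(3,4)] by (auto simp: next_B_def)

lemma next_A_mono:
  assumes "w \<in> min_reps W2 I2 L J2" "L \<subseteq> I2" "w' \<in> generate W2 L #>\<^bsub>W2\<^esub> w" "L' \<subseteq> L"
  shows "next_A w' L' \<subseteq> next_A w L"
  using C2.conj_set_inv_Int_subset[OF assms(1,2) subsets(3) assms(3,4)] by (auto simp: next_A_def)

lemma T_data_subset:
  assumes "T_data A B w1 w2"
  shows "A n \<subseteq> J1" "B n \<subseteq> J2'" "A n \<subseteq> I1" "B n \<subseteq> I2"
proof -
  show "A n \<subseteq> J1" "B n \<subseteq> J2'"
    using assms unfolding T_data_def by blast+
  then show "A n \<subseteq> I1" "B n \<subseteq> I2"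
    using subsets by auto
qed

lemma T_dataD:
  assumes "T_data A B w1 w2"
  shows "A 0 = J1" "A (Suc n) = next_A (w2 n) (B n)" "B n = next_B (w1 n) (A n)"
    "w1 n \<in> min_reps W1 I1 J1' (A n)" "w2 n \<in> min_reps W2 I2 (B n) J2"
    "w1 (Suc n) \<in> w1 n <#\<^bsub>W1\<^esub> generate W1 (A n)"
    "w2 (Suc n) \<in> generate W2 (B n) #>\<^bsub>W2\<^esub> w2 n"
  using assms unfolding T_data_def by blast+

text \<open>The inclusions alternate: \<open>A 1\<close> lies in \<open>J1 = A 0\<close>, a decrease
  of \<open>A\<close> forces one of \<open>B\<close> by \<open>next_B_mono\<close>, and this forces
  the next decrease of \<open>A\<close> by \<open>next_A_mono\<close>.\<close>

lemma T_data_antimono: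
  assumes T: "T_data A B w1 w2"
  shows "A (Suc n) \<subseteq> A n" "B (Suc n) \<subseteq> B n"
proof -
  note D = T_dataD[OF T] and sub = T_data_subset[OF T]
  have B: "B (Suc n) \<subseteq> B n" if "A (Suc n) \<subseteq> A n" for n
    using next_B_mono[OF D(4) sub(3) D(6) that] unfolding D(3)[symmetric] .
  have A: "A (Suc n) \<subseteq> A n" for n
  proof (induction n)
    case 0
    then show ?case using sub(1) D(1) by simp
  next
    case (Suc n)
    show ?case
      using next_A_mono[OF D(5) sub(4) D(7) B[OF Suc]] unfolding D(2)[symmetric] .
  qed
  show "A (Suc n) \<subseteq> A n" "B (Suc n) \<subseteq> B n"
    using A B by blast+
qed

lemma T_data_stable:
  assumes "T_data A B w1 w2"
  shows "\<exists>N. \<forall>n\<ge>N. A n = A N \<and> B n = B N"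
proof -
  note dec = T_data_antimono[OF assms]
  have "finite (A 0)" "finite (B 0)"
    using finite_subset[OF T_data_subset(3)[OF assms] C1.finite_S]
      finite_subset[OF T_data_subset(4)[OF assms] C2.finite_S] by auto
  then obtain M N where "\<And>n. n \<ge> M \<Longrightarrow> A n = A M" "\<And>n. n \<ge> N \<Longrightarrow> B n = B N"
    using decseq_finite_stable[of A, OF dec(1)] decseq_finite_stable[of B, OF dec(2)] by auto
  then have "A n = A (max M N) \<and> B n = B (max M N)" if "n \<ge> max M N" for n
    using that by (metis max.bounded_iff max.cobounded1 max.cobounded2)
  then show ?thesis by blast
qed

section \<open>The recursion that rebuilds a sequence from its limit\<close>

text \<open>At each index the other three components are determined by \<open>p\<close> and
  \<open>seq_A\<close>, so only \<open>seq_A\<close> is recursive. Its body inlines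
  \<open>seq_w1\<close>, \<open>seq_B\<close> and \<open>seq_w2\<close>; \<open>seq_A_Suc\<close>
  makes this explicit.\<close>

primrec seq_A :: "'a \<times> 'b \<Rightarrow> nat \<Rightarrow> 'a set" where
  "seq_A p 0 = J1"
| "seq_A p (Suc n) =
    (let K = seq_A p n; L = next_B (C1.right_rep (fst p) K) K
     in next_A (C2.left_rep L (snd p)) L)"

definition seq_w1 :: "'a \<times> 'b \<Rightarrow> nat \<Rightarrow> 'a" where
  "seq_w1 p n = C1.right_rep (fst p) (seq_A p n)"

definition seq_B :: "'a \<times> 'b \<Rightarrow> nat \<Rightarrow> 'b set" where
  "seq_B p n = next_B (seq_w1 p n) (seq_A p n)"

definition seq_w2 :: "'a \<times> 'b \<Rightarrow> nat \<Rightarrow> 'b" where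
  "seq_w2 p n = C2.left_rep (seq_B p n) (snd p)"

definition seq :: "'a \<times> 'b \<Rightarrow> nat \<Rightarrow> 'a set \<times> 'b set \<times> 'a \<times> 'b" where
  "seq p n = (seq_A p n, seq_B p n, seq_w1 p n, seq_w2 p n)"

lemma seq_A_Suc: "seq_A p (Suc n) = next_A (seq_w2 p n) (seq_B p n)"
  by (simp add: seq_w2_def seq_B_def seq_w1_def Let_def)

declare seq_A.simps(2) [simp del]

definition targets :: "('a \<times> 'b) set" where
  "targets = min_reps_left W1 I1 J1' \<times> min_reps_right W2 I2 J2"

text \<open>Since \<open>A n\<close> and \<open>B n\<close> decrease, all later \<open>w1 m\<close> lie in the coset of \<open>w1 n\<close> modulo
  \<open>A n\<close>; so the limit determines \<open>w1 n\<close>, and likewise \<open>w2 n\<close>.\<close>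

lemma T_data_eventually:
  assumes T: "T_data A B w1 w2"
  obtains p where "p \<in> targets" "\<forall>\<^sub>F n in sequentially. (w1 n, w2 n) = p"
    "(\<lambda>n. (A n, B n, w1 n, w2 n)) = seq p"
proof -
  obtain N where N: "\<And>n. n \<ge> N \<Longrightarrow> A n = A N" "\<And>n. n \<ge> N \<Longrightarrow> B n = B N"
    using T_data_stable[OF T] by blast
  note sub = T_data_subset(3,4)[OF T]
  have dec: "A n \<subseteq> A m" "B n \<subseteq> B m" if "m \<le> n" for m n
    using that T_data_antimono[OF T] lift_Suc_antimono_le[of A] lift_Suc_antimono_le[of B]
    by blast+
  have w: "w1 n \<in> min_reps_left W1 I1 J1'" "w1 n \<in> min_reps_right W1 I1 (A n)"
      "w2 n \<in> min_reps_left W2 I2 (B n)" "w2 n \<in> min_reps_right W2 I2 J2" for n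
    using T by (auto simp: T_data_def min_reps_def)
  have c: "w1 n \<in> carrier W1" "w2 n \<in> carrier W2" for n
    using w C1.min_reps_left_carrier C2.min_reps_left_carrier by blast+
  have next_w: "w1 (Suc n) \<in> w1 n <#\<^bsub>W1\<^esub> generate W1 (A n)"
      "w2 (Suc n) \<in> generate W2 (B n) #>\<^bsub>W2\<^esub> w2 n" for n
    using T by (auto simp: T_data_def)
  have later: "w1 m \<in> w1 n <#\<^bsub>W1\<^esub> generate W1 (A n) \<and>
      w2 m \<in> generate W2 (B n) #>\<^bsub>W2\<^esub> w2 n" if "n \<le> m" for n m
    using that
  proof (induction rule: dec_induct)
    case base
    then show ?case
      using C1.mem_own_l_coset C2.mem_own_r_coset c by blast
  next
    case (step m)
    then show ?case
      using C1.l_coset_generate_trans C2.r_coset_generate_trans c sub dec next_w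
      by (meson less_imp_le)
  qed
  define p where "p = (w1 N, w2 N)"
  have const: "(w1 n, w2 n) = p" if "n \<ge> N" for n
  proof -
    have "w1 n = w1 N"
      using C1.min_rep_right_unique[OF w(2) _ sub(1)] later[OF that] w(2)[of n] N(1)[OF that]
      by simp
    moreover have "w2 n = w2 N"
      using C2.min_rep_left_unique[OF w(3) _ sub(2)] later[OF that] w(3)[of n] N(2)[OF that]
      by simp
    ultimately show ?thesis
      by (simp add: p_def)
  qed
  \<comment> \<open>The index \<open>max n N\<close> is late enough for both facts: it is not before
    \<open>n\<close>, and the pair is already constant there.\<close>
  have lim: "fst p \<in> w1 n <#\<^bsub>W1\<^esub> generate W1 (A n) \<and>
      snd p \<in> generate W2 (B n) #>\<^bsub>W2\<^esub> w2 n" for n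
    using later[of n "max n N"] const[of "max n N"] by (auto simp: p_def)
  have rep: "w1 n = C1.right_rep (fst p) (A n)" "w2 n = C2.left_rep (B n) (snd p)" for n
    using C1.right_rep_eq[OF w(2) _ sub(1)] C2.left_rep_eq[OF w(3) _ sub(2)] lim by metis+
  have A: "A n = seq_A p n" for n
  proof (induction n)
    case 0
    then show ?case using T by (simp add: T_data_def)
  next
    case (Suc n)
    have "A (Suc n) = next_A (w2 n) (B n)" "B n = next_B (w1 n) (A n)"
      using T by (auto simp: T_data_def)
    then show ?case
      using Suc rep[of n] by (simp add: seq_A_Suc seq_w2_def seq_B_def seq_w1_def)
  qed
  have w1: "w1 n = seq_w1 p n" for n
    using rep A by (simp add: seq_w1_def)
  have B: "B n = seq_B p n" for n
    using T w1 A by (simp add: seq_B_def T_data_def)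
  have w2: "w2 n = seq_w2 p n" for n
    using rep B by (simp add: seq_w2_def)
  have "(\<lambda>n. (A n, B n, w1 n, w2 n)) = seq p"
    using A B w1 w2 by (simp add: seq_def fun_eq_iff)
  moreover have "p \<in> targets"
    using w by (simp add: p_def targets_def)
  moreover have "\<forall>\<^sub>F n in sequentially. (w1 n, w2 n) = p"
    using const eventually_sequentially by blast
  ultimately show thesis
    using that by blast
qed

text \<open>Double minimality (d) comes from \<open>p\<close>. Condition (e) needs decreasing index
  sets, while their decrease needs (e), so the implications are stated conditionally and then closed
  by induction on \<open>n\<close>.\<close>

lemma seq_T_data:
  assumes p: "p \<in> targets"
  shows "T_data (seq_A p) (seq_B p) (seq_w1 p) (seq_w2 p)"
proof -
  have A: "seq_A p n \<subseteq> J1" for n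
    using next_A_subset by (cases n) (auto simp: seq_A_Suc)
  have B: "seq_B p n \<subseteq> J2'" for n
    using next_B_subset by (simp add: seq_B_def)
  have AI: "seq_A p n \<subseteq> I1" and BI: "seq_B p n \<subseteq> I2" for n
    using A B subsets by blast+
  have p': "fst p \<in> min_reps_left W1 I1 J1'" "snd p \<in> min_reps_right W2 I2 J2"
    using p by (auto simp: targets_def)
  have c: "fst p \<in> carrier W1" "snd p \<in> carrier W2"
    using p' C1.min_reps_left_carrier C2.min_reps_right_carrier by auto
  have w1: "seq_w1 p n \<in> min_reps W1 I1 J1' (seq_A p n)" for n
    unfolding seq_w1_def using C1.right_rep_left_min[OF p'(1) AI subsets(2)] .
  have w2: "seq_w2 p n \<in> min_reps W2 I2 (seq_B p n) J2" for n
    unfolding seq_w2_def using C2.left_rep_right_min[OF p'(2) BI subsets(3)] .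
  have step1: "seq_w1 p (Suc n) \<in> seq_w1 p n <#\<^bsub>W1\<^esub> generate W1 (seq_A p n)"
    if "seq_A p (Suc n) \<subseteq> seq_A p n" for n
    unfolding seq_w1_def using C1.right_rep_mono[OF c(1) that AI] .
  have step2: "seq_w2 p (Suc n) \<in> generate W2 (seq_B p n) #>\<^bsub>W2\<^esub> seq_w2 p n"
    if "seq_B p (Suc n) \<subseteq> seq_B p n" for n
    unfolding seq_w2_def using C2.left_rep_mono[OF c(2) that BI] .
  have decB: "seq_B p (Suc n) \<subseteq> seq_B p n" if "seq_A p (Suc n) \<subseteq> seq_A p n" for n
    using next_B_mono[OF w1 AI step1[OF that] that] unfolding seq_B_def .
  have decA: "seq_A p (Suc n) \<subseteq> seq_A p n" for n
  proof (induction n)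
    case 0
    then show ?case using A by simp
  next
    case (Suc n)
    show ?case
      using next_A_mono[OF w2 BI step2[OF decB[OF Suc]] decB[OF Suc]]
      by (simp only: seq_A_Suc)
  qed
  have "seq_w1 p n \<in> carrier W1" "seq_w2 p n \<in> carrier W2" for n
    using w1 w2 C1.min_reps_left_carrier C2.min_reps_left_carrier unfolding min_reps_def by blast+
  then show ?thesis
    unfolding T_data_def
    using w1 w2 step1[OF decA] step2[OF decB[OF decA]] seq_A_Suc A B
    by (simp add: seq_B_def[symmetric])
qed

text \<open>Passing from \<open>A n\<close> to \<open>B n\<close> and from \<open>B n\<close> to \<open>A (Suc n)\<close> cannot increase
  cardinalities. So once both are stable nothing is lost in the intersections with \<open>J1'\<close> and \<open>J2\<close>,
  that is, conjugation by \<open>w1\<close> carries \<open>A\<close> into \<open>J1'\<close>. Then \<open>fst p\<close>, which lies in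
  \<open>w1 W\<^sub>A \<subseteq> W\<^bsub>J1'\<^esub> w1\<close> and is left minimal for \<open>J1'\<close>, equals \<open>w1\<close>.\<close>

lemma seq_eventually:
  assumes p: "p \<in> targets"
  shows "\<forall>\<^sub>F n in sequentially. (seq_w1 p n, seq_w2 p n) = p"
proof -
  note T = seq_T_data[OF p]
  note sub = T_data_subset[OF T]
  obtain N where N: "\<And>n. n \<ge> N \<Longrightarrow> seq_A p n = seq_A p N" "\<And>n. n \<ge> N \<Longrightarrow> seq_B p n = seq_B p N"
    using T_data_stable[OF T] by blast
  have p': "fst p \<in> min_reps_left W1 I1 J1'" "snd p \<in> min_reps_right W2 I2 J2"
    using p by (auto simp: targets_def)
  have c: "fst p \<in> carrier W1" "snd p \<in> carrier W2"
    using p' C1.min_reps_left_carrier C2.min_reps_right_carrier by auto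
  have "(seq_w1 p n, seq_w2 p n) = p" if n: "n \<ge> N" for n
  proof -
    define A B w1 w2 where "A = seq_A p n" and "B = seq_B p n" and "w1 = seq_w1 p n"
      and "w2 = seq_w2 p n"
    have "seq_A p (Suc n) = seq_A p n"
      using N(1)[OF n] N(1)[of "Suc n"] n by simp
    then have AB: "A = next_A w2 B" "B = next_B w1 A" "A \<subseteq> I1" "B \<subseteq> I2"
      using seq_A_Suc[of p n] sub(3,4)[of n] by (simp_all add: A_def B_def w1_def w2_def seq_B_def)
    have w: "w1 \<in> min_reps_left W1 I1 J1'" "w2 \<in> min_reps_right W2 I2 J2"
      using T by (auto simp: T_data_def min_reps_def w1_def w2_def)
    have wc: "w1 \<in> carrier W1" "inv\<^bsub>W2\<^esub> w2 \<in> carrier W2"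
      using w C1.min_reps_left_carrier C2.min_reps_right_carrier by auto
    have fin: "finite (conj_set W1 w1 A)" "finite (conj_set W2 (inv\<^bsub>W2\<^esub> w2) B)"
      unfolding conj_set_def
      using AB(3,4) C1.finite_S C2.finite_S by (auto intro: finite_imageI finite_subset)
    have dA: "\<delta> ` A \<subseteq> conj_set W2 (inv\<^bsub>W2\<^esub> w2) B \<inter> J2"
      using AB(1) by (auto simp: next_A_def)
    have cA: "card A = card (\<delta> ` A)"
      using AB(1) inj_delta by (intro card_image[symmetric] inj_on_subset[OF inj_delta])
        (auto simp: next_A_def)
    have card2: "card A \<le> card (conj_set W2 (inv\<^bsub>W2\<^esub> w2) B \<inter> J2)"
      using dA fin cA by (simp add: card_mono)
    have cB: "card (conj_set W2 (inv\<^bsub>W2\<^esub> w2) B) = card B"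
      using C2.card_conj_set wc AB by blast
    have card1: "card B \<le> card (conj_set W1 w1 A \<inter> J1')"
      using AB(2) fin by (simp add: next_B_def card_image_le)
    have cA': "card (conj_set W1 w1 A) = card A"
      using C1.card_conj_set wc AB by blast
    \<comment> \<open>With \<open>card1\<close> and \<open>card2\<close> this closes a cycle of
      inequalities from \<open>card A\<close> through \<open>card B\<close> back to
      \<open>card A\<close>. All are equalities, and by finiteness both intersections are
      everything.\<close>
    have "card (conj_set W2 (inv\<^bsub>W2\<^esub> w2) B \<inter> J2) \<le> card B"
        "card (conj_set W1 w1 A \<inter> J1') \<le> card A"
      using fin cA' cB by (metis card_mono inf_le1)+
    then have "conj_set W1 w1 A \<inter> J1' = conj_set W1 w1 A"
        "conj_set W2 (inv\<^bsub>W2\<^esub> w2) B \<inter> J2 = conj_set W2 (inv\<^bsub>W2\<^esub> w2) B"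
      using card1 card2 cA' cB fin by (intro card_subset_eq; simp)+
    then have conj: "conj_set W1 w1 A \<subseteq> J1'" "conj_set W2 (inv\<^bsub>W2\<^esub> w2) B \<subseteq> J2"
      by blast+
    have "fst p \<in> w1 <#\<^bsub>W1\<^esub> generate W1 A" "snd p \<in> generate W2 B #>\<^bsub>W2\<^esub> w2"
      using C1.right_rep(2)[OF c(1) AB(3)] C2.left_rep(2)[OF c(2) AB(4)]
      by (auto simp: w1_def w2_def A_def B_def seq_w1_def seq_w2_def)
    then have "fst p = w1" "snd p = w2"
      using C1.l_coset_min_rep_left_eq[OF w(1) p'(1) AB(3) subsets(2) conj(1)]
        C2.r_coset_min_rep_right_eq[OF w(2) p'(2) AB(4) subsets(3) conj(2)] by blast+
    then show ?thesis
      by (auto simp: w1_def w2_def prod_eq_iff)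
  qed
  then show ?thesis
    using eventually_sequentially by blast
qed

end

section \<open>The limit map and its inverse\<close>

lemma eventual_value_eq:
  assumes "\<forall>\<^sub>F m in sequentially. f m = p"
  shows "eventual_value f = p"
  unfolding eventual_value_def
proof (rule the_equality)
  fix q assume "\<forall>\<^sub>F m in sequentially. f m = q"
  with assms have "\<forall>\<^sub>F m in sequentially. q = p"
    by eventually_elim simp
  \<comment> \<open>The filter \<open>sequentially\<close> is nontrivial, so a constant statement
    that holds eventually is true.\<close>
  then show "q = p" by simp
qed (rule assms)

theorem proposition1p7:
  fixes W1 :: "('a, 'm) monoid_scheme" and I1 J1 J1' :: "'a set"
    and W2 :: "('b, 'n) monoid_scheme" and I2 J2 J2' :: "'b set"
    and \<delta> \<delta>' :: "'a \<Rightarrow> 'b"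
  assumes "coxeter_group W1 I1" and "coxeter_group W2 I2"
    and "admissible_triple W1 I1 W2 I2 J1 J2 \<delta>"
    and "admissible_triple W1 I1 W2 I2 J1' J2' \<delta>'"
  shows "(\<forall>\<sigma> \<in> T_seqs W1 I1 W2 I2 J1 J2 \<delta> J1' J2' \<delta>'.
            \<exists>p. \<forall>\<^sub>F m in sequentially. snd (snd (\<sigma> m)) = p)
       \<and> bij_betw (\<lambda>\<sigma>. eventual_value (\<lambda>m. snd (snd (\<sigma> m))))
            (T_seqs W1 I1 W2 I2 J1 J2 \<delta> J1' J2' \<delta>')
            (min_reps_left W1 I1 J1' \<times> min_reps_right W2 I2 J2)"
proof -
  interpret P: admissible_pair W1 I1 W2 I2 J1 J1' J2 J2' \<delta> \<delta>'
    using assms by (simp add: admissible_pair_def admissible_pair_axioms_def)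
  let ?ev = "\<lambda>\<sigma>. eventual_value (\<lambda>m. snd (snd (\<sigma> m)))"
  have T: "\<exists>p \<in> P.targets. (\<forall>\<^sub>F m in sequentially. snd (snd (\<sigma> m)) = p) \<and> \<sigma> = P.seq p"
    if \<sigma>: "\<sigma> \<in> P.T" for \<sigma>
  proof -
    obtain A B w1 w2 where AB: "\<sigma> = (\<lambda>n. (A n, B n, w1 n, w2 n))" "P.T_data A B w1 w2"
      using \<sigma> P.T_iff by blast
    then obtain p where p: "p \<in> P.targets" "\<forall>\<^sub>F n in sequentially. (w1 n, w2 n) = p"
        "\<sigma> = P.seq p"
      using P.T_data_eventually[OF AB(2)] by blast
    from p(2) have "\<forall>\<^sub>F n in sequentially. snd (snd (\<sigma> n)) = p"
      by (simp add: AB(1))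
    then show ?thesis
      using p by blast
  qed
  have seq: "P.seq p \<in> P.T" "?ev (P.seq p) = p" if p: "p \<in> P.targets" for p
  proof -
    show "P.seq p \<in> P.T"
      using P.T_iff P.seq_T_data[OF p] P.seq_def by blast
    show "?ev (P.seq p) = p"
      using P.seq_eventually[OF p] by (intro eventual_value_eq) (simp add: P.seq_def)
  qed
  have "bij_betw ?ev P.T P.targets"
  \<comment> \<open>The inverse map is \<open>P.seq\<close>: by \<open>T\<close> a sequence is
    rebuilt from its limit, and by \<open>seq\<close> a rebuilt sequence has the given pair as its
    limit.\<close>
  proof (rule bij_betw_byWitness[where f' = P.seq])
    show "\<forall>\<sigma>\<in>P.T. P.seq (?ev \<sigma>) = \<sigma>" "?ev ` P.T \<subseteq> P.targets"
      using T seq(2) by force+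
  qed (use seq in auto)
  then show ?thesis
    using T unfolding P.targets_def by blast
qed

end
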